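(* Let $f_{\mathrm{st}}=\frac12\left(1+\frac1{\sqrt3}\right)$ and let $f_{\mathrm{st}}<f\le 1$. For each positive integer $n$ let $$\sigma_{\mathrm{INS}}(n)=q_{\max}\,\tau_0^{\otimes n}+(1-q_{\max})\,\frac{\mathbb{1}}{2^n},\qquad q_{\max}=q_{\max}(n)=\left[1+(2f_{\mathrm{st}})^{n-1}(\sqrt3-1)\right]^{-1}.$$ Then there exist $f'_n\in[0,1]$ such that, for every $n$, $\sigma_{\mathrm{INS}}(n)\otimes\tau(f)^{\otimes (n-1)}\rightarrow_P\tau(f'_n)$, and $f'_n\to1$ as $n\to\infty$.
   Context: $X,Y,Z$ are the single-qubit Pauli matrices. $\tau_0=\frac12\left(1+\frac{X+Y+Z}{\sqrt3}\right)$ and $\tau_1=\frac12\left(1-\frac{X+Y+Z}{\sqrt3}\right)$ are orthogonal rank-one projectors (onto the eigenstates of the Clifford gate $T$ satisfying $TXT^\dagger=Y$, $TYT^\dagger=Z$). The noisy $T$-state of fidelity $f$ is $\tau(f)=f\tau_0+(1-f)\tau_1$. $\mathbb{1}$ denotes the identity operator. The Clifford group on $n$ qubits is the group of unitaries $C$ such that $CpC^\dagger$ is a Pauli operator (a tensor product of $1,X,Y,Z$, up to sign) for every Pauli operator $p$. A pure stabilizer state on $n$ qubits is the unique (up to phase) common $+1$ eigenvector of $n$ commuting, independent signed Pauli operators; a (mixed) stabilizer state is a convex mixture of pure stabilizer states. A Clifford computer is a device capable of performing ideal Clifford unitaries, preparation of stabilizer states, classical feedforward (later operations may depend on earlier classical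 outcomes), classical randomness, and Pauli measurements; qubits may be discarded (partial trace). We write $\rho\rightarrow_P\rho'$ if a Clifford computer can take the input state $\rho$ and with nonzero probability (i.e. with postselection on classical outcomes occurring with nonzero probability) output the state $\rho'$. *)

theory Defs
  imports Complex_Main "Jordan_Normal_Form.Schur_Decomposition"
begin

text \<open>
  An operator on \<open>n\<close> qubits is a complex \<open>2^n \<times> 2^n\<close> matrix; basis states are ordered
  lexicographically, with qubit 0 as the leftmost tensor factor (most significant bit).
\<close>

section \<open>Tensor products, trace, partial trace\<close>

definition tensor :: "complex mat \<Rightarrow> complex mat \<Rightarrow> complex mat" (infixl "\<Otimes>" 72) where
  "A \<Otimes> B = mat (dim_row A * dim_row B) (dim_col A * dim_col B)
     (\<lambda>(i, j). A $$ (i div dim_row B, j div dim_col B) * B $$ (i mod dim_row B, j mod dim_col B))"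

primrec tensor_pow :: "complex mat \<Rightarrow> nat \<Rightarrow> complex mat" where
  "tensor_pow A 0 = 1\<^sub>m 1"
| "tensor_pow A (Suc n) = A \<Otimes> tensor_pow A n"

definition mat_trace :: "complex mat \<Rightarrow> complex" where
  "mat_trace A = (\<Sum>i<dim_row A. A $$ (i, i))"

definition bra :: "nat \<Rightarrow> complex mat" where
  "bra b = mat 1 2 (\<lambda>(i, j). if j = b then 1 else 0)"

definition bra_at :: "nat \<Rightarrow> nat \<Rightarrow> nat \<Rightarrow> complex mat" where
  "bra_at n k b = 1\<^sub>m (2 ^ k) \<Otimes> bra b \<Otimes> 1\<^sub>m (2 ^ (n - Suc k))"

text \<open>Partial trace over qubit \<open>k\<close> of an \<open>n\<close>-qubit operator (\<open>k < n\<close>).\<close>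

definition partial_trace :: "nat \<Rightarrow> nat \<Rightarrow> complex mat \<Rightarrow> complex mat" where
  "partial_trace n k \<rho> =
     bra_at n k 0 * \<rho> * mat_adjoint (bra_at n k 0) +
     bra_at n k 1 * \<rho> * mat_adjoint (bra_at n k 1)"

section \<open>Pauli operators, Clifford unitaries, stabilizer states\<close>

definition X_mat :: "complex mat" where
  "X_mat = mat_of_rows_list 2 [[0, 1], [1, 0]]"

definition Y_mat :: "complex mat" where
  "Y_mat = mat_of_rows_list 2 [[0, - \<i>], [\<i>, 0]]"

definition Z_mat :: "complex mat" where
  "Z_mat = mat_of_rows_list 2 [[1, 0], [0, -1]]"

definition pauli_string :: "complex mat list \<Rightarrow> complex mat" where
  "pauli_string ps = foldr (\<Otimes>) ps (1\<^sub>m 1)"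

definition pauli_ops :: "nat \<Rightarrow> complex mat set" where
  "pauli_ops n = {s \<cdot>\<^sub>m pauli_string ps | s ps.
     s \<in> {1, -1} \<and> length ps = n \<and> set ps \<subseteq> {1\<^sub>m 2, X_mat, Y_mat, Z_mat}}"

definition unitary_mat :: "nat \<Rightarrow> complex mat \<Rightarrow> bool" where
  "unitary_mat d U \<longleftrightarrow>
     U \<in> carrier_mat d d \<and> U * mat_adjoint U = 1\<^sub>m d \<and> mat_adjoint U * U = 1\<^sub>m d"

definition clifford_group :: "nat \<Rightarrow> complex mat set" where
  "clifford_group n = {C. unitary_mat (2 ^ n) C \<and>
     (\<forall>p \<in> pauli_ops n. C * p * mat_adjoint C \<in> pauli_ops n)}"

text \<open>Independence of commuting signed Pauli operators: no product over a nonempty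
  subfamily is the identity up to sign.\<close>

definition independent_paulis :: "nat \<Rightarrow> complex mat list \<Rightarrow> bool" where
  "independent_paulis n gs \<longleftrightarrow> (\<forall>S \<subseteq> {..<length gs}. S \<noteq> {} \<longrightarrow>
     foldr (*) (nths gs S) (1\<^sub>m (2 ^ n)) \<notin> {1\<^sub>m (2 ^ n), - 1\<^sub>m (2 ^ n)})"

text \<open>The common \<open>+1\<close> eigenspace of \<open>n\<close> commuting, independent signed Pauli operators is
  one-dimensional, so a normalized common \<open>+1\<close> eigenvector is unique up to phase and
  its density matrix \<open>|\<psi>\<rangle>\<langle>\<psi>|\<close> is unique.\<close>

definition stabilizer_vec :: "nat \<Rightarrow> complex vec \<Rightarrow> bool" where
  "stabilizer_vec n \<psi> \<longleftrightarrow> \<psi> \<in> carrier_vec (2 ^ n) \<and> \<psi> \<bullet>c \<psi> = 1 \<and>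
     (\<exists>gs. length gs = n \<and> set gs \<subseteq> pauli_ops n \<and>
        (\<forall>g \<in> set gs. \<forall>h \<in> set gs. g * h = h * g) \<and>
        independent_paulis n gs \<and> (\<forall>g \<in> set gs. g *\<^sub>v \<psi> = \<psi>))"

definition pure_density :: "complex vec \<Rightarrow> complex mat" where
  "pure_density \<psi> = mat (dim_vec \<psi>) (dim_vec \<psi>) (\<lambda>(i, j). \<psi> $ i * cnj (\<psi> $ j))"

inductive_set stabilizer_states :: "nat \<Rightarrow> complex mat set" for n where
  pure: "stabilizer_vec n \<psi> \<Longrightarrow> pure_density \<psi> \<in> stabilizer_states n"
| mix: "\<rho> \<in> stabilizer_states n \<Longrightarrow> \<sigma> \<in> stabilizer_states n \<Longrightarrow> 0 \<le> p \<Longrightarrow> p \<le> 1 \<Longrightarrow>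
    complex_of_real p \<cdot>\<^sub>m \<rho> + complex_of_real (1 - p) \<cdot>\<^sub>m \<sigma> \<in> stabilizer_states n"

section \<open>Clifford computers\<close>

text \<open>
  A run of a Clifford computer is a finite decision tree: the branches of \<open>Coin\<close> and
  \<open>Measure\<close> are the continuations chosen by a random bit or a measurement outcome
  (feedforward).  A leaf determines the whole classical record of the run; its flag tells
  whether that record is accepted by the postselection.
\<close>

datatype protocol =
    Halt bool
  | Clifford "complex mat" protocol
  | Prepare nat "complex mat" protocol
  | Discard nat protocol
  | Coin real protocol protocol
  | Measure "complex mat" protocol protocol

text \<open>\<open>valid m P n\<close>: \<open>P\<close> is an admissible protocol acting on \<open>n\<close> qubits all of whose
  accepting leaves hold \<open>m\<close> qubits.\<close>

primrec valid :: "nat \<Rightarrow> protocol \<Rightarrow> nat \<Rightarrow> bool" where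
  "valid m (Halt acc) n \<longleftrightarrow> (acc \<longrightarrow> n = m)"
| "valid m (Clifford C P) n \<longleftrightarrow> C \<in> clifford_group n \<and> valid m P n"
| "valid m (Prepare l \<sigma> P) n \<longleftrightarrow> \<sigma> \<in> stabilizer_states l \<and> valid m P (n + l)"
| "valid m (Discard k P) n \<longleftrightarrow> k < n \<and> valid m P (n - 1)"
| "valid m (Coin p P Q) n \<longleftrightarrow> 0 \<le> p \<and> p \<le> 1 \<and> valid m P n \<and> valid m Q n"
| "valid m (Measure M P Q) n \<longleftrightarrow> M \<in> pauli_ops n \<and> valid m P n \<and> valid m Q n"

definition pauli_projector :: "nat \<Rightarrow> complex \<Rightarrow> complex mat \<Rightarrow> complex mat" where
  "pauli_projector n s M = (1 / 2) \<cdot>\<^sub>m (1\<^sub>m (2 ^ n) + s \<cdot>\<^sub>m M)"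

text \<open>\<open>run m P n \<rho>\<close> is the unnormalized output: the sum over the accepting leaves of
  probability times conditional state.  Its trace is the acceptance probability.\<close>

primrec run :: "nat \<Rightarrow> protocol \<Rightarrow> nat \<Rightarrow> complex mat \<Rightarrow> complex mat" where
  "run m (Halt acc) n \<rho> = (if acc then \<rho> else 0\<^sub>m (2 ^ m) (2 ^ m))"
| "run m (Clifford C P) n \<rho> = run m P n (C * \<rho> * mat_adjoint C)"
| "run m (Prepare l \<sigma> P) n \<rho> = run m P (n + l) (\<rho> \<Otimes> \<sigma>)"
| "run m (Discard k P) n \<rho> = run m P (n - 1) (partial_trace n k \<rho>)"
| "run m (Coin p P Q) n \<rho> =
     complex_of_real p \<cdot>\<^sub>m run m P n \<rho> + complex_of_real (1 - p) \<cdot>\<^sub>m run m Q n \<rho>"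
| "run m (Measure M P Q) n \<rho> =
     run m P n (pauli_projector n 1 M * \<rho> * pauli_projector n 1 M) +
     run m Q n (pauli_projector n (-1) M * \<rho> * pauli_projector n (-1) M)"

text \<open>\<open>cc_postselect n m \<rho> \<rho>'\<close> is the relation \<open>\<rho> \<rightarrow>\<^sub>P \<rho>'\<close> from \<open>n\<close>-qubit to \<open>m\<close>-qubit states.\<close>

definition cc_postselect :: "nat \<Rightarrow> nat \<Rightarrow> complex mat \<Rightarrow> complex mat \<Rightarrow> bool" where
  "cc_postselect n m \<rho> \<rho>' \<longleftrightarrow> \<rho> \<in> carrier_mat (2 ^ n) (2 ^ n) \<and>
     (\<exists>P. valid m P n \<and> mat_trace (run m P n \<rho>) \<noteq> 0 \<and>
        \<rho>' = (1 / mat_trace (run m P n \<rho>)) \<cdot>\<^sub>m run m P n \<rho>)"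

section \<open>Noisy \<open>T\<close>-states and the state \<open>\<sigma>\<^sub>I\<^sub>N\<^sub>S\<close>\<close>

definition tau0 :: "complex mat" where
  "tau0 = (1 / 2) \<cdot>\<^sub>m (1\<^sub>m 2 + complex_of_real (1 / sqrt 3) \<cdot>\<^sub>m (X_mat + Y_mat + Z_mat))"

definition tau1 :: "complex mat" where
  "tau1 = (1 / 2) \<cdot>\<^sub>m (1\<^sub>m 2 - complex_of_real (1 / sqrt 3) \<cdot>\<^sub>m (X_mat + Y_mat + Z_mat))"

definition tau :: "real \<Rightarrow> complex mat" where
  "tau f = complex_of_real f \<cdot>\<^sub>m tau0 + complex_of_real (1 - f) \<cdot>\<^sub>m tau1"

definition f_st :: real where
  "f_st = (1 / 2) * (1 + 1 / sqrt 3)"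

definition q_max :: "nat \<Rightarrow> real" where
  "q_max n = inverse (1 + (2 * f_st) ^ (n - 1) * (sqrt 3 - 1))"

definition sigma_INS :: "nat \<Rightarrow> complex mat" where
  "sigma_INS n = complex_of_real (q_max n) \<cdot>\<^sub>m tensor_pow tau0 n +
     complex_of_real (1 - q_max n) \<cdot>\<^sub>m ((1 / 2 ^ n) \<cdot>\<^sub>m 1\<^sub>m (2 ^ n))"

end

theory Submission
  imports Defs
begin

text \<open>
  Pair \<open>n - 1\<close> qubits of \<open>\<sigma>\<^sub>I\<^sub>N\<^sub>S\<close> with the \<open>n - 1\<close> copies of \<open>\<tau>(f)\<close>.  On each pair measure the Pauli
  operators \<open>X \<otimes> Y\<close> and \<open>Y \<otimes> X\<close>, postselect both on the outcome \<open>+1\<close>, and discard the pair; this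
  projects it onto a Bell state.  The projection succeeds on \<open>\<tau>\<^sub>0 \<otimes> \<tau>(f)\<close> with probability \<open>f / 2\<close>
  and on \<open>(1 / 2) \<otimes> \<tau>(f)\<close> with probability \<open>1 / 4\<close>.  Hence the last qubit is left in a mixture of
  \<open>\<tau>\<^sub>0\<close> and \<open>1 / 2\<close> with weights in the ratio \<open>1 : x\<close>, where
  \<open>x = (1 - q) / q * (1 / (2 f))\<^bsup>n - 1\<^esup> = (sqrt 3 - 1) (f\<^sub>s\<^sub>t / f)\<^bsup>n - 1\<^esup>\<close>, and \<open>x\<close> tends to 0 as \<open>f > f\<^sub>s\<^sub>t\<close>.
\<close>

section \<open>Tensor products\<close>

lemma tensor_dim [simp]:
  "dim_row (A \<Otimes> B) = dim_row A * dim_row B"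
  "dim_col (A \<Otimes> B) = dim_col A * dim_col B"
  by (simp_all add: tensor_def)

lemma tensor_carrier [intro]:
  "A \<in> carrier_mat a b \<Longrightarrow> B \<in> carrier_mat c d \<Longrightarrow> A \<Otimes> B \<in> carrier_mat (a * c) (b * d)"
  by (intro carrier_matI) simp_all

lemma tensor_index:
  "i < dim_row A * dim_row B \<Longrightarrow> j < dim_col A * dim_col B \<Longrightarrow>
   (A \<Otimes> B) $$ (i, j) = A $$ (i div dim_row B, j div dim_col B) * B $$ (i mod dim_row B, j mod dim_col B)"
  by (simp add: tensor_def)

lemma div_mod_less_mult:
  fixes i a b :: nat
  assumes "i < a * b"
  shows "i div b < a" "i mod b < b" "0 < b"
proof -
  show "0 < b" using assms by (cases b) auto
  then show "i mod b < b" by simp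
  show "i div b < a" using assms by (simp add: less_mult_imp_div_less)
qed

lemma mod_mult_div_mod:
  fixes i b c :: nat
  assumes "0 < c"
  shows "i mod (b * c) div c = i div c mod b" "i mod (b * c) mod c = i mod c"
  unfolding mult.commute[of b c] using assms by (simp_all add: mod_mult2_eq)

lemma div_mult_div: "i div (b * c) = i div c div (b :: nat)"
  by (metis div_mult2_eq mult.commute)

text \<open>Both groupings read the same three mixed-radix digits off a row or column index;
  \<open>mod_mult_div_mod\<close> and \<open>div_mult_div\<close> translate the digits of one
  grouping into those of the other.\<close>

lemma tensor_assoc: "A \<Otimes> B \<Otimes> C = A \<Otimes> (B \<Otimes> C)"
proof (rule eq_matI, goal_cases)
  case (1 i j)
  then have i: "i < dim_row A * dim_row B * dim_row C" and j: "j < dim_col A * dim_col B * dim_col C"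
    by (simp_all add: mult.assoc)
  note di = div_mod_less_mult[OF i] and dj = div_mod_less_mult[OF j]
  have i': "i < dim_row A * (dim_row B * dim_row C)" and j': "j < dim_col A * (dim_col B * dim_col C)"
    using i j by (simp_all only: mult.assoc)
  note ei = div_mod_less_mult[OF i'] and ej = div_mod_less_mult[OF j']
  have "(A \<Otimes> B \<Otimes> C) $$ (i, j) = A $$ (i div dim_row C div dim_row B, j div dim_col C div dim_col B) *
      B $$ (i div dim_row C mod dim_row B, j div dim_col C mod dim_col B) * C $$ (i mod dim_row C, j mod dim_col C)"
    using i j di(1) dj(1) by (simp add: tensor_index)
  moreover have "(A \<Otimes> (B \<Otimes> C)) $$ (i, j) = A $$ (i div dim_row C div dim_row B, j div dim_col C div dim_col B) *
      (B $$ (i div dim_row C mod dim_row B, j div dim_col C mod dim_col B) * C $$ (i mod dim_row C, j mod dim_col C))"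
    using i' j' di(3) dj(3) ei(2) ej(2) by (simp add: tensor_index mod_mult_div_mod div_mult_div)
  ultimately show ?case by (simp only: mult.assoc)
qed simp_all

lemma less_mult_add:
  fixes i j a b :: nat
  assumes "i < a" "j < b"
  shows "i * b + j < a * b"
proof -
  have "i * b + j < Suc i * b" using assms by simp
  also have "\<dots> \<le> a * b" using assms by (intro mult_le_mono1) simp
  finally show ?thesis .
qed

lemma tensor_index_block:
  assumes "A \<in> carrier_mat a b" "B \<in> carrier_mat c d" "i < a" "j < b" "k < c" "l < d"
  shows "(A \<Otimes> B) $$ (i * c + k, j * d + l) = A $$ (i, j) * B $$ (k, l)"
  using assms by (simp add: tensor_index less_mult_add)

text \<open>Every index below \<open>a * c\<close> has the form \<open>i * c + k\<close>, so tensor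
  identities can be checked in block coordinates, without \<open>div\<close> and
  \<open>mod\<close>.\<close>

lemma eq_mat_blockI:
  assumes M: "M \<in> carrier_mat (a * c) (b * d)" and N: "N \<in> carrier_mat (a * c) (b * d)"
    and eq: "\<And>i j k l. i < a \<Longrightarrow> j < b \<Longrightarrow> k < c \<Longrightarrow> l < d \<Longrightarrow>
      M $$ (i * c + k, j * d + l) = N $$ (i * c + k, j * d + l)"
  shows "M = N"
proof (rule eq_matI)
  fix i j assume "i < dim_row N" "j < dim_col N"
  then have i: "i < a * c" and j: "j < b * d" using N by simp_all
  from eq[OF div_mod_less_mult(1)[OF i] div_mod_less_mult(1)[OF j]
      div_mod_less_mult(2)[OF i] div_mod_less_mult(2)[OF j]]
  show "M $$ (i, j) = N $$ (i, j)" by simp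
qed (use M N in simp_all)

lemma tensor_add_left:
  assumes "A \<in> carrier_mat a b" "A' \<in> carrier_mat a b" "B \<in> carrier_mat c d"
  shows "(A + A') \<Otimes> B = A \<Otimes> B + A' \<Otimes> B"
  by (rule eq_mat_blockI[of _ a c b d])
    (use assms in \<open>simp_all add: tensor_index_block[of _ a b _ c d] less_mult_add tensor_carrier distrib_right\<close>)

lemma tensor_add_right:
  assumes "A \<in> carrier_mat a b" "B \<in> carrier_mat c d" "B' \<in> carrier_mat c d"
  shows "A \<Otimes> (B + B') = A \<Otimes> B + A \<Otimes> B'"
  by (rule eq_mat_blockI[of _ a c b d])
    (use assms in \<open>simp_all add: tensor_index_block[of _ a b _ c d] less_mult_add tensor_carrier distrib_left\<close>)

lemma tensor_smult_left: "(c \<cdot>\<^sub>m A) \<Otimes> B = c \<cdot>\<^sub>m (A \<Otimes> B)"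
proof (rule eq_matI, goal_cases)
  case (1 i j)
  then have i: "i < dim_row A * dim_row B" and j: "j < dim_col A * dim_col B" by simp_all
  with div_mod_less_mult(1)[OF i] div_mod_less_mult(1)[OF j] show ?case by (simp add: tensor_index)
qed simp_all

lemma tensor_smult_right: "A \<Otimes> (c \<cdot>\<^sub>m B) = c \<cdot>\<^sub>m (A \<Otimes> B)"
proof (rule eq_matI, goal_cases)
  case (1 i j)
  then have i: "i < dim_row A * dim_row B" and j: "j < dim_col A * dim_col B" by simp_all
  with div_mod_less_mult(2)[OF i] div_mod_less_mult(2)[OF j] show ?case by (simp add: tensor_index)
qed simp_all

lemma block_index_inject:
  fixes i j k l c :: nat
  assumes "k < c" "l < c"
  shows "i * c + k = j * c + l \<longleftrightarrow> i = j \<and> k = l"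
proof
  assume eq: "i * c + k = j * c + l"
  have "(i * c + k) div c = i" "(j * c + l) div c = j" "(i * c + k) mod c = k" "(j * c + l) mod c = l"
    using assms by simp_all
  with eq show "i = j \<and> k = l" by simp
qed simp

lemma tensor_one_one: "1\<^sub>m a \<Otimes> 1\<^sub>m b = 1\<^sub>m (a * b)"
  by (rule eq_mat_blockI[of _ a b a b])
    (simp_all add: tensor_index_block[of _ a a _ b b] less_mult_add tensor_carrier carrier_matI block_index_inject)

lemma tensor_one_left [simp]: "1\<^sub>m (Suc 0) \<Otimes> A = A"
  by (intro eq_matI) (auto simp: tensor_index)

lemma tensor_one_right [simp]: "A \<Otimes> 1\<^sub>m (Suc 0) = A"
  by (intro eq_matI) (auto simp: tensor_index)

section \<open>The mixed-product rule\<close>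

lemma sum_div_mod:
  fixes f g :: "nat \<Rightarrow> complex"
  shows "(\<Sum>k<a * b. f (k div b) * g (k mod b)) = (\<Sum>i<a. f i) * (\<Sum>j<b. g j)"
proof (cases "b = 0")
  case False
  show ?thesis
    unfolding sum_product sum.cartesian_product
    by (rule sum.reindex_bij_witness[of _ "\<lambda>(i, j). i * b + j" "\<lambda>k. (k div b, k mod b)"])
      (use False in \<open>auto simp: div_mod_less_mult(1) intro: less_mult_add\<close>)
qed auto

lemma mult_index_sum:
  assumes "A \<in> carrier_mat a b" "B \<in> carrier_mat b c" "i < a" "j < c"
  shows "(A * B) $$ (i, j) = (\<Sum>k<b. A $$ (i, k) * B $$ (k, j))"
  using assms by (auto simp: scalar_prod_def lessThan_atLeast0 intro!: sum.cong)

text \<open>The summation index of the matrix product splits into quotient and remainder. The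
  summand separates accordingly, so the sum factors by \<open>sum_div_mod\<close>.\<close>

lemma tensor_mult_distrib:
  assumes A: "A \<in> carrier_mat a b" and B: "B \<in> carrier_mat c d"
    and C: "C \<in> carrier_mat b e" and D: "D \<in> carrier_mat d g"
  shows "(A \<Otimes> B) * (C \<Otimes> D) = (A * C) \<Otimes> (B * D)"
proof (rule eq_matI, goal_cases)
  case (1 i j)
  then have i: "i < a * c" and j: "j < e * g" using assms by auto
  note di = div_mod_less_mult[OF i] and dj = div_mod_less_mult[OF j]
  have "((A \<Otimes> B) * (C \<Otimes> D)) $$ (i, j) = (\<Sum>k<b * d. (A \<Otimes> B) $$ (i, k) * (C \<Otimes> D) $$ (k, j))"
    by (rule mult_index_sum[OF tensor_carrier[OF A B] tensor_carrier[OF C D] i j])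
  also have "\<dots> = (\<Sum>k<b * d. (A $$ (i div c, k div d) * C $$ (k div d, j div g)) *
      (B $$ (i mod c, k mod d) * D $$ (k mod d, j mod g)))"
    using i j A B C D by (intro sum.cong) (auto simp: tensor_index)
  also have "\<dots> = (A * C) $$ (i div c, j div g) * (B * D) $$ (i mod c, j mod g)"
    unfolding mult_index_sum[OF A C di(1) dj(1)] mult_index_sum[OF B D di(2) dj(2)]
    by (rule sum_div_mod)
  also have "\<dots> = ((A * C) \<Otimes> (B * D)) $$ (i, j)"
    using i j carrier_matD[OF A] carrier_matD[OF B] carrier_matD[OF C] carrier_matD[OF D]
    by (simp add: tensor_index del: index_mult_mat(1))
  finally show ?case .
qed (use carrier_matD[OF A] carrier_matD[OF B] carrier_matD[OF C] carrier_matD[OF D] in simp_all)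

section \<open>Adjoints and tensor powers\<close>

lemma mat_adjoint_dim [simp]:
  "dim_row (mat_adjoint A) = dim_col A" "dim_col (mat_adjoint A) = dim_row A"
  by (simp_all add: mat_adjoint_def)

lemma mat_adjoint_carrier [intro]: "A \<in> carrier_mat a b \<Longrightarrow> mat_adjoint A \<in> carrier_mat b a"
  by (intro carrier_matI) simp_all

lemma mat_adjoint_index:
  "i < dim_col A \<Longrightarrow> j < dim_row A \<Longrightarrow> mat_adjoint A $$ (i, j) = cnj (A $$ (j, i))"
  by (simp add: mat_adjoint_def mat_of_rows_index)

lemma mat_adjoint_tensor: "mat_adjoint (A \<Otimes> B) = mat_adjoint A \<Otimes> mat_adjoint B"
proof (rule eq_matI, goal_cases)
  case (1 i j)
  then have i: "i < dim_col A * dim_col B" and j: "j < dim_row A * dim_row B" by simp_all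
  note d = div_mod_less_mult(1,2)[OF i] div_mod_less_mult(1,2)[OF j]
  from i j d show ?case by (simp add: mat_adjoint_index tensor_index)
qed simp_all

lemma mat_adjoint_one [simp]: "mat_adjoint (1\<^sub>m n :: complex mat) = 1\<^sub>m n"
  by (rule eq_matI) (auto simp: mat_adjoint_index)

lemma tensor_pow_carrier:
  "A \<in> carrier_mat 2 2 \<Longrightarrow> tensor_pow A n \<in> carrier_mat (2 ^ n) (2 ^ n)"
  by (induction n) auto

lemma tensor_pow_Suc_right: "tensor_pow A (Suc n) = tensor_pow A n \<Otimes> A"
  by (induction n) (simp_all add: tensor_assoc[symmetric])

section \<open>Operators acting on a block of qubits\<close>

text \<open>Every state of the accepted run is kept as a combination of two tensor products.
  Measurement projections and partial traces are built from such conjugations, so each summand can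
  be followed separately.\<close>

lemma mat_conj_linear:
  fixes K :: "complex mat"
  assumes K: "K \<in> carrier_mat m n" and \<rho>: "\<rho> \<in> carrier_mat n n" and \<sigma>: "\<sigma> \<in> carrier_mat n n"
  shows "K * (x \<cdot>\<^sub>m \<rho> + y \<cdot>\<^sub>m \<sigma>) * mat_adjoint K =
    x \<cdot>\<^sub>m (K * \<rho> * mat_adjoint K) + y \<cdot>\<^sub>m (K * \<sigma> * mat_adjoint K)"
proof -
  have K': "mat_adjoint K \<in> carrier_mat n m" using K by (rule mat_adjoint_carrier)
  have "K * (x \<cdot>\<^sub>m \<rho> + y \<cdot>\<^sub>m \<sigma>) = x \<cdot>\<^sub>m (K * \<rho>) + y \<cdot>\<^sub>m (K * \<sigma>)"
    using assms by (simp add: mult_add_distrib_mat[of _ m n _ n] mult_smult_distrib[of _ m n _ n])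
  also have "\<dots> * mat_adjoint K =
      x \<cdot>\<^sub>m (K * \<rho> * mat_adjoint K) + y \<cdot>\<^sub>m (K * \<sigma> * mat_adjoint K)"
    using assms K' by (simp add: add_mult_distrib_mat[of _ m n _ _ m] mult_smult_assoc_mat[of _ m n _ m]
        mult_carrier_mat[of _ m n _ n])
  finally show ?thesis .
qed

text \<open>\<open>Q\<close> may be rectangular, so that one notion covers both the projectors on a
  pair and the bras that remove a qubit.\<close>

definition local_op :: "nat \<Rightarrow> complex mat \<Rightarrow> nat \<Rightarrow> complex mat" where
  "local_op a Q b = 1\<^sub>m (2 ^ a) \<Otimes> Q \<Otimes> 1\<^sub>m (2 ^ b)"

lemma local_op_carrier:
  "Q \<in> carrier_mat s t \<Longrightarrow> local_op a Q b \<in> carrier_mat (2 ^ a * s * 2 ^ b) (2 ^ a * t * 2 ^ b)"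
  unfolding local_op_def by (intro tensor_carrier) auto

lemma local_op_conj:
  assumes Q: "Q \<in> carrier_mat s t" and L: "L \<in> carrier_mat (2 ^ a) (2 ^ a)"
    and S: "S \<in> carrier_mat t t" and R: "R \<in> carrier_mat (2 ^ b) (2 ^ b)"
  shows "local_op a Q b * (L \<Otimes> S \<Otimes> R) * mat_adjoint (local_op a Q b) =
    L \<Otimes> (Q * S * mat_adjoint Q) \<Otimes> R"
proof -
  have Q': "mat_adjoint Q \<in> carrier_mat t s" using Q by (rule mat_adjoint_carrier)
  have QS: "Q * S \<in> carrier_mat s t" using Q S by (rule mult_carrier_mat)
  have "local_op a Q b * (L \<Otimes> S \<Otimes> R) = L \<Otimes> (Q * S) \<Otimes> R"
    unfolding local_op_def
    by (simp add: tensor_mult_distrib[OF tensor_carrier[OF one_carrier_mat Q] one_carrier_mat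
          tensor_carrier[OF L S] R] tensor_mult_distrib[OF one_carrier_mat Q L S]
        left_mult_one_mat[OF L] left_mult_one_mat[OF R])
  then show ?thesis
    unfolding local_op_def mat_adjoint_tensor mat_adjoint_one
    by (simp add: tensor_mult_distrib[OF tensor_carrier[OF L QS] R
          tensor_carrier[OF one_carrier_mat Q'] one_carrier_mat] tensor_mult_distrib[OF L QS one_carrier_mat Q']
        right_mult_one_mat[OF L] right_mult_one_mat[OF R])
qed

lemma one_smult_mat: "1 \<cdot>\<^sub>m (A :: complex mat) = A"
  by (rule eq_matI) simp_all

lemma smult_smult_mat: "x \<cdot>\<^sub>m (y \<cdot>\<^sub>m (A :: complex mat)) = (x * y) \<cdot>\<^sub>m A"
  by (rule eq_matI) simp_all

lemma pauli_projector_local_op: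
  assumes W: "W \<in> carrier_mat 4 4"
  shows "pauli_projector (a + 2 + b) 1 (local_op a W b) = local_op a ((1 / 2) \<cdot>\<^sub>m (1\<^sub>m 4 + W)) b"
proof -
  have "(1\<^sub>m (2 ^ (a + 2 + b)) :: complex mat) = 1\<^sub>m (2 ^ a) \<Otimes> 1\<^sub>m 4 \<Otimes> 1\<^sub>m (2 ^ b)"
    by (simp add: tensor_one_one power_add ac_simps)
  moreover have "1\<^sub>m (2 ^ a) \<Otimes> (1\<^sub>m 4 + W) \<Otimes> 1\<^sub>m (2 ^ b) =
      (1\<^sub>m (2 ^ a) \<Otimes> 1\<^sub>m 4 \<Otimes> 1\<^sub>m (2 ^ b)) + (1\<^sub>m (2 ^ a) \<Otimes> W \<Otimes> 1\<^sub>m (2 ^ b))"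
    using W by (simp add: tensor_add_right[of _ "2 ^ a" "2 ^ a" _ 4 4]
        tensor_add_left[of _ "2 ^ a * 4" "2 ^ a * 4" _ _ "2 ^ b" "2 ^ b"] tensor_carrier)
  ultimately show ?thesis
    unfolding pauli_projector_def local_op_def
    by (simp add: tensor_smult_left tensor_smult_right one_smult_mat)
qed

text \<open>In the second form one identity factor on the right is absorbed into the middle, so that
  a bra on the first qubit of a pair becomes an operator on the whole pair.\<close>

lemma bra_at_eq_local_op:
  "bra_at (a + 1 + b) a \<beta> = local_op a (bra \<beta>) b"
  "bra_at (a + 2 + b) a \<beta> = local_op a (bra \<beta> \<Otimes> 1\<^sub>m 2) b"
proof -
  show "bra_at (a + 1 + b) a \<beta> = local_op a (bra \<beta>) b"
    by (simp add: bra_at_def local_op_def)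
  have "(1\<^sub>m (2 ^ Suc b) :: complex mat) = 1\<^sub>m 2 \<Otimes> 1\<^sub>m (2 ^ b)" by (simp add: tensor_one_one)
  then show "bra_at (a + 2 + b) a \<beta> = local_op a (bra \<beta> \<Otimes> 1\<^sub>m 2) b"
    by (simp add: bra_at_def local_op_def tensor_assoc)
qed

lemma bra_carrier: "bra \<beta> \<in> carrier_mat 1 2"
  by (simp add: bra_def)

section \<open>Pauli matrices and Pauli strings\<close>

lemma X_mat_index [simp]:
  "X_mat $$ (0, 0) = 0" "X_mat $$ (0, Suc 0) = 1" "X_mat $$ (Suc 0, 0) = 1" "X_mat $$ (Suc 0, Suc 0) = 0"
  "dim_row X_mat = 2" "dim_col X_mat = 2"
  by (simp_all add: X_mat_def mat_of_rows_list_def)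

lemma Y_mat_index [simp]:
  "Y_mat $$ (0, 0) = 0" "Y_mat $$ (0, Suc 0) = - \<i>" "Y_mat $$ (Suc 0, 0) = \<i>" "Y_mat $$ (Suc 0, Suc 0) = 0"
  "dim_row Y_mat = 2" "dim_col Y_mat = 2"
  by (simp_all add: Y_mat_def mat_of_rows_list_def)

lemma Z_mat_index [simp]:
  "Z_mat $$ (0, 0) = 1" "Z_mat $$ (0, Suc 0) = 0" "Z_mat $$ (Suc 0, 0) = 0" "Z_mat $$ (Suc 0, Suc 0) = - 1"
  "dim_row Z_mat = 2" "dim_col Z_mat = 2"
  by (simp_all add: Z_mat_def mat_of_rows_list_def)

lemma X_Y_carrier: "X_mat \<in> carrier_mat 2 2" "Y_mat \<in> carrier_mat 2 2"
  by (intro carrier_matI; simp)+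

lemma pauli_string_append: "pauli_string (ps @ qs) = pauli_string ps \<Otimes> pauli_string qs"
  by (induction ps) (simp_all add: pauli_string_def tensor_assoc)

lemma pauli_string_replicate_one: "pauli_string (replicate n (1\<^sub>m 2)) = 1\<^sub>m (2 ^ n)"
  by (induction n) (simp_all add: pauli_string_def tensor_one_one)

lemma local_op_in_pauli_ops:
  assumes "{p, q} \<subseteq> {1\<^sub>m 2, X_mat, Y_mat, Z_mat}"
  shows "local_op a (p \<Otimes> q) b \<in> pauli_ops (a + 2 + b)"
proof -
  let ?ps = "replicate a (1\<^sub>m 2) @ [p, q] @ replicate b (1\<^sub>m 2)"
  have "pauli_string [p, q] = p \<Otimes> q" by (simp add: pauli_string_def)
  then have "local_op a (p \<Otimes> q) b = 1 \<cdot>\<^sub>m pauli_string ?ps"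
    unfolding pauli_string_append pauli_string_replicate_one local_op_def
    by (auto simp: tensor_assoc)
  moreover have "length ?ps = a + 2 + b" by simp
  moreover have "set ?ps \<subseteq> {1\<^sub>m 2, X_mat, Y_mat, Z_mat}" using assms by auto
  ultimately show ?thesis unfolding pauli_ops_def by blast
qed

section \<open>Projecting a pair of qubits onto a Bell state\<close>

text \<open>The projector onto \<open>(|00\<rangle> + \<i>|11\<rangle>) / sqrt 2\<close>, the Bell state stabilized by \<open>X \<otimes> Y\<close>,
  \<open>Y \<otimes> X\<close> and \<open>Z \<otimes> Z\<close>.\<close>

definition bell_projector :: "complex mat" where
  "bell_projector = (1 / 2) \<cdot>\<^sub>m
     mat_of_rows_list 4 [[1, 0, 0, - \<i>], [0, 0, 0, 0], [0, 0, 0, 0], [\<i>, 0, 0, 1]]"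

definition XY_projector :: "complex mat" where
  "XY_projector = (1 / 2) \<cdot>\<^sub>m (1\<^sub>m 4 + (X_mat \<Otimes> Y_mat))"

definition YX_projector :: "complex mat" where
  "YX_projector = (1 / 2) \<cdot>\<^sub>m (1\<^sub>m 4 + (Y_mat \<Otimes> X_mat))"

lemma eq_mat_4I:
  assumes "A \<in> carrier_mat 4 4" "B \<in> carrier_mat 4 4"
    and "\<And>i j. i \<in> {0, 1, 2, 3} \<Longrightarrow> j \<in> {0, 1, 2, 3} \<Longrightarrow> A $$ (i, j) = B $$ (i, j)"
  shows "A = B"
proof (rule eq_matI)
  fix i j assume "i < dim_row B" "j < dim_col B"
  then have "i \<in> {0, 1, 2, 3}" "j \<in> {0, 1, 2, 3}" using assms(2) by auto
  then show "A $$ (i, j) = B $$ (i, j)" by (rule assms(3))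
qed (use assms in simp_all)

lemma XY_projector_eq: "XY_projector = (1 / 2) \<cdot>\<^sub>m mat_of_rows_list 4
    [[1, 0, 0, - \<i>], [0, 1, \<i>, 0], [0, - \<i>, 1, 0], [\<i>, 0, 0, 1]]"
  by (rule eq_mat_4I; (rule carrier_matI)?)
    (auto simp: XY_projector_def mat_of_rows_list_def tensor_index)

lemma YX_projector_eq: "YX_projector = (1 / 2) \<cdot>\<^sub>m mat_of_rows_list 4
    [[1, 0, 0, - \<i>], [0, 1, - \<i>, 0], [0, \<i>, 1, 0], [\<i>, 0, 0, 1]]"
  by (rule eq_mat_4I; (rule carrier_matI)?)
    (auto simp: YX_projector_def mat_of_rows_list_def tensor_index)

lemma projector_carrier:
  "XY_projector \<in> carrier_mat 4 4" "YX_projector \<in> carrier_mat 4 4" "bell_projector \<in> carrier_mat 4 4"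
  by (intro carrier_matI; simp add: XY_projector_eq YX_projector_eq bell_projector_def mat_of_rows_list_def)+

lemma projector_adjoint:
  "mat_adjoint XY_projector = XY_projector" "mat_adjoint YX_projector = YX_projector"
  by (rule eq_mat_4I;
      auto simp: projector_carrier mat_adjoint_carrier XY_projector_eq YX_projector_eq
        mat_of_rows_list_def mat_adjoint_index carrier_matI)+

text \<open>\<open>X_mat\<close> and \<open>Y_mat\<close> anticommute on each of the two qubits, so
  the two measured operators commute. The product of their projectors is therefore the projector
  onto the joint \<open>+1\<close> eigenspace, which is a line.\<close>

lemma YX_XY_projector: "YX_projector * XY_projector = bell_projector"
  by (rule eq_matI)
    (auto simp: XY_projector_eq YX_projector_eq bell_projector_def mat_of_rows_list_def scalar_prod_def
      numeral_eq_Suc less_Suc_eq)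

lemma XY_YX_projector: "XY_projector * YX_projector = bell_projector"
  by (rule eq_matI)
    (auto simp: XY_projector_eq YX_projector_eq bell_projector_def mat_of_rows_list_def scalar_prod_def
      numeral_eq_Suc less_Suc_eq)

text \<open>Compression by a rank-one projector leaves a multiple of it; the factor is the
  expectation of \<open>S\<close> in the Bell vector
  \<open>(1, 0, 0, \<i>) / sqrt 2\<close>.\<close>

lemma bell_projector_conj:
  assumes "S \<in> carrier_mat 4 4"
  shows "bell_projector * S * bell_projector =
    ((S $$ (0, 0) + \<i> * S $$ (0, 3) - \<i> * S $$ (3, 0) + S $$ (3, 3)) / 2) \<cdot>\<^sub>m bell_projector"
  using assms by (intro eq_matI)
    (auto simp: bell_projector_def mat_of_rows_list_def scalar_prod_def
      numeral_eq_Suc less_Suc_eq field_simps)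

lemma tensor_pair_carrier:
  assumes "L \<in> carrier_mat (2 ^ a) (2 ^ a)" "S \<in> carrier_mat 4 4" "R \<in> carrier_mat (2 ^ b) (2 ^ b)"
  shows "L \<Otimes> S \<Otimes> R \<in> carrier_mat (2 ^ (a + 2 + b)) (2 ^ (a + 2 + b))"
  using tensor_carrier[OF tensor_carrier[OF assms(1,2)] assms(3)]
  by (simp add: power_add ac_simps)

text \<open>The probability of projecting \<open>A \<otimes> B\<close> onto the Bell state.\<close>

definition bell_weight :: "complex mat \<Rightarrow> complex mat \<Rightarrow> complex" where
  "bell_weight A B = (A $$ (0, 0) * B $$ (0, 0) + \<i> * (A $$ (0, 1) * B $$ (0, 1))
     - \<i> * (A $$ (1, 0) * B $$ (1, 0)) + A $$ (1, 1) * B $$ (1, 1)) / 2"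

lemma bell_projector_conj_tensor:
  assumes "A \<in> carrier_mat 2 2" "B \<in> carrier_mat 2 2"
  shows "bell_projector * (A \<Otimes> B) * bell_projector = bell_weight A B \<cdot>\<^sub>m bell_projector"
proof -
  have "A \<Otimes> B \<in> carrier_mat 4 4" using tensor_carrier[OF assms] by simp
  from bell_projector_conj[OF this] show ?thesis
    using assms by (simp add: bell_weight_def tensor_index)
qed

text \<open>After reassociation the projectors merge in one order on the left of \<open>S\<close>
  and in the other on its right; since they commute, both products are the Bell projector.\<close>

lemma XY_YX_conj:
  assumes S: "S \<in> carrier_mat 4 4"
  shows "YX_projector * (XY_projector * S * XY_projector) * YX_projector =
    bell_projector * S * bell_projector"
proof -
  note c = projector_carrier(1,2)
  have XS: "XY_projector * S \<in> carrier_mat 4 4" using c(1) S by (rule mult_carrier_mat)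
  have YXS: "YX_projector * (XY_projector * S) \<in> carrier_mat 4 4" using c(2) XS by (rule mult_carrier_mat)
  have "YX_projector * (XY_projector * S * XY_projector) * YX_projector =
      YX_projector * (XY_projector * S) * XY_projector * YX_projector"
    by (simp only: assoc_mult_mat[OF c(2) XS c(1)])
  also have "\<dots> = YX_projector * (XY_projector * S) * (XY_projector * YX_projector)"
    by (rule assoc_mult_mat[OF YXS c])
  also have "YX_projector * (XY_projector * S) = YX_projector * XY_projector * S"
    by (simp only: assoc_mult_mat[OF c(2) c(1) S])
  finally show ?thesis by (simp only: XY_YX_projector YX_XY_projector)
qed

section \<open>The two postselected measurements\<close>

abbreviation measured :: "nat \<Rightarrow> nat \<Rightarrow> complex mat \<Rightarrow> complex mat \<Rightarrow> complex mat" where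
  "measured a b W \<rho> \<equiv> pauli_projector (a + 2 + b) 1 (local_op a W b) * \<rho> *
     pauli_projector (a + 2 + b) 1 (local_op a W b)"

lemma local_projector:
  "pauli_projector (a + 2 + b) 1 (local_op a (X_mat \<Otimes> Y_mat) b) = local_op a XY_projector b"
  "pauli_projector (a + 2 + b) 1 (local_op a (Y_mat \<Otimes> X_mat) b) = local_op a YX_projector b"
  "mat_adjoint (local_op a XY_projector b) = local_op a XY_projector b"
  "mat_adjoint (local_op a YX_projector b) = local_op a YX_projector b"
  using tensor_carrier[OF X_Y_carrier] tensor_carrier[OF X_Y_carrier(2) X_Y_carrier(1)]
  by (simp_all add: pauli_projector_local_op XY_projector_def[symmetric] YX_projector_def[symmetric]
      del: add_2_eq_Suc add_2_eq_Suc')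
    (simp_all add: local_op_def mat_adjoint_tensor projector_adjoint)

text \<open>The projectors are Hermitian, so a measurement branch is a conjugation to which
  \<open>mat_conj_linear\<close> applies.\<close>

lemma measured_linear:
  assumes "W = X_mat \<Otimes> Y_mat \<or> W = Y_mat \<Otimes> X_mat"
    and "\<rho> \<in> carrier_mat (2 ^ (a + 2 + b)) (2 ^ (a + 2 + b))"
    and "\<sigma> \<in> carrier_mat (2 ^ (a + 2 + b)) (2 ^ (a + 2 + b))"
  shows "measured a b W (x \<cdot>\<^sub>m \<rho> + y \<cdot>\<^sub>m \<sigma>) = x \<cdot>\<^sub>m measured a b W \<rho> + y \<cdot>\<^sub>m measured a b W \<sigma>"
proof -
  obtain P where P: "P \<in> carrier_mat 4 4" "mat_adjoint (local_op a P b) = local_op a P b"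
    "pauli_projector (a + 2 + b) 1 (local_op a W b) = local_op a P b"
    using assms(1) local_projector projector_carrier by metis
  have "local_op a P b \<in> carrier_mat (2 ^ (a + 2 + b)) (2 ^ (a + 2 + b))"
    using local_op_carrier[OF P(1), of a b] by (simp add: power_add ac_simps)
  from mat_conj_linear[OF this assms(2,3)] show ?thesis by (simp only: P)
qed

lemma measured_XY_YX:
  assumes L: "L \<in> carrier_mat (2 ^ a) (2 ^ a)" and R: "R \<in> carrier_mat (2 ^ b) (2 ^ b)"
    and A: "A \<in> carrier_mat 2 2" and B: "B \<in> carrier_mat 2 2"
  shows "measured a b (X_mat \<Otimes> Y_mat) (L \<Otimes> (A \<Otimes> B) \<Otimes> R) =
      L \<Otimes> (XY_projector * (A \<Otimes> B) * XY_projector) \<Otimes> R" (is ?XY)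
    and "measured a b (Y_mat \<Otimes> X_mat) (L \<Otimes> (XY_projector * (A \<Otimes> B) * XY_projector) \<Otimes> R) =
      bell_weight A B \<cdot>\<^sub>m (L \<Otimes> bell_projector \<Otimes> R)" (is ?YX)
proof -
  have S: "A \<Otimes> B \<in> carrier_mat 4 4" using tensor_carrier[OF A B] by simp
  from local_op_conj[OF projector_carrier(1) L S R]
  show ?XY by (simp only: local_projector projector_adjoint)
  have S': "XY_projector * (A \<Otimes> B) * XY_projector \<in> carrier_mat 4 4"
    using mult_carrier_mat[OF mult_carrier_mat[OF projector_carrier(1) S] projector_carrier(1)] .
  from local_op_conj[OF projector_carrier(2) L S' R]
  show ?YX by (simp only: local_projector projector_adjoint XY_YX_conj[OF S]
        bell_projector_conj_tensor[OF A B] tensor_smult_left tensor_smult_right)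
qed

section \<open>Discarding the projected pair\<close>

lemma bra_at_carrier:
  assumes "k < n"
  shows "bra_at n k \<beta> \<in> carrier_mat (2 ^ (n - 1)) (2 ^ n)"
proof -
  obtain b where n: "n = k + 1 + b" using assms by (metis Suc_eq_plus1 add_Suc_right less_iff_Suc_add add.commute)
  show ?thesis unfolding n bra_at_eq_local_op(1)
    using local_op_carrier[OF bra_carrier, of k \<beta> b] by (simp add: power_add ac_simps)
qed

lemma partial_trace_linear:
  assumes "k < n" "\<rho> \<in> carrier_mat (2 ^ n) (2 ^ n)" "\<sigma> \<in> carrier_mat (2 ^ n) (2 ^ n)"
  shows "partial_trace n k (x \<cdot>\<^sub>m \<rho> + y \<cdot>\<^sub>m \<sigma>) = x \<cdot>\<^sub>m partial_trace n k \<rho> + y \<cdot>\<^sub>m partial_trace n k \<sigma>"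
proof -
  let ?K = "\<lambda>\<beta>. bra_at n k \<beta>"
  note K = bra_at_carrier[OF assms(1)]
  have c: "?K \<beta> * M * mat_adjoint (?K \<beta>) \<in> carrier_mat (2 ^ (n - 1)) (2 ^ (n - 1))"
    if "M \<in> carrier_mat (2 ^ n) (2 ^ n)" for M \<beta>
    by (rule mult_carrier_mat[OF mult_carrier_mat[OF K that] mat_adjoint_carrier[OF K]])
  note cs = c[OF assms(2), of 0] c[OF assms(2), of 1] c[OF assms(3), of 0] c[OF assms(3), of 1]
  show ?thesis
    unfolding partial_trace_def mat_conj_linear[OF K assms(2,3)]
    by (rule eq_matI)
      (use cs[THEN carrier_matD(1)] cs[THEN carrier_matD(2)] in
        \<open>simp_all add: distrib_left del: index_mult_mat\<close>)
qed

lemma bra_trace: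
  "bra 0 * ((1 / 2) \<cdot>\<^sub>m 1\<^sub>m 2) * mat_adjoint (bra 0) + bra 1 * ((1 / 2) \<cdot>\<^sub>m 1\<^sub>m 2) * mat_adjoint (bra 1) = 1\<^sub>m 1"
  by (rule eq_matI) (auto simp: bra_def scalar_prod_def mat_adjoint_index numeral_eq_Suc)

lemma bra_tensor_one:
  "bra \<beta> \<Otimes> 1\<^sub>m 2 = mat 2 4 (\<lambda>(i, j). if j = 2 * \<beta> + i then 1 else 0)"
proof (rule eq_matI, goal_cases)
  case (1 i j)
  then have "i < 2" "j < 4" by simp_all
  moreover from this have "j div 2 < 2" "j mod 2 < 2" "j = 2 * \<beta> + i \<longleftrightarrow> j div 2 = \<beta> \<and> i = j mod 2"
    by auto
  ultimately show ?case by (simp add: tensor_index bra_def)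
qed (simp_all add: bra_def)

text \<open>The Bell state is maximally entangled, so tracing out its first qubit leaves the second
  one maximally mixed.\<close>

lemma bell_trace:
  "(bra 0 \<Otimes> 1\<^sub>m 2) * bell_projector * mat_adjoint (bra 0 \<Otimes> 1\<^sub>m 2) +
   (bra 1 \<Otimes> 1\<^sub>m 2) * bell_projector * mat_adjoint (bra 1 \<Otimes> 1\<^sub>m 2) = (1 / 2) \<cdot>\<^sub>m 1\<^sub>m 2"
  unfolding bra_tensor_one
  by (rule eq_matI) (auto simp: bell_projector_def mat_of_rows_list_def scalar_prod_def
      mat_adjoint_index numeral_eq_Suc less_Suc_eq)

lemma local_op_conj_add:
  assumes Q: "Q \<in> carrier_mat s t" "Q' \<in> carrier_mat s t" and L: "L \<in> carrier_mat (2 ^ a) (2 ^ a)"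
    and S: "S \<in> carrier_mat t t" and R: "R \<in> carrier_mat (2 ^ b) (2 ^ b)"
  shows "local_op a Q b * (L \<Otimes> S \<Otimes> R) * mat_adjoint (local_op a Q b) +
    local_op a Q' b * (L \<Otimes> S \<Otimes> R) * mat_adjoint (local_op a Q' b) =
    L \<Otimes> (Q * S * mat_adjoint Q + Q' * S * mat_adjoint Q') \<Otimes> R"
proof -
  have c: "Q * S * mat_adjoint Q \<in> carrier_mat s s" "Q' * S * mat_adjoint Q' \<in> carrier_mat s s"
    using Q S by (auto intro!: mult_carrier_mat mat_adjoint_carrier)
  show ?thesis
    unfolding local_op_conj[OF Q(1) L S R] local_op_conj[OF Q(2) L S R]
      tensor_add_right[OF L c]
    by (rule tensor_add_left[OF tensor_carrier[OF L c(1)] tensor_carrier[OF L c(2)] R, symmetric])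
qed

text \<open>Both traces act at position \<open>a\<close>, since the second qubit of the pair moves
  there once the first is gone. The Bell projector has trace one, so no weight is lost.\<close>

lemma partial_trace_bell:
  assumes L: "L \<in> carrier_mat (2 ^ a) (2 ^ a)" and R: "R \<in> carrier_mat (2 ^ b) (2 ^ b)"
  shows "partial_trace (a + 1 + b) a (partial_trace (a + 2 + b) a (L \<Otimes> bell_projector \<Otimes> R)) = L \<Otimes> R"
proof -
  have b1: "bra \<beta> \<Otimes> 1\<^sub>m 2 \<in> carrier_mat 2 4" for \<beta>
    using tensor_carrier[OF bra_carrier one_carrier_mat, of \<beta> 2] by simp
  have h: "(1 / 2) \<cdot>\<^sub>m 1\<^sub>m 2 \<in> carrier_mat 2 2" by simp
  show ?thesis
    unfolding partial_trace_def bra_at_eq_local_op local_op_conj_add[OF b1 b1 L projector_carrier(3) R]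
      bell_trace local_op_conj_add[OF bra_carrier bra_carrier L h R] bra_trace
    by simp
qed

section \<open>The protocol\<close>

text \<open>Postselection is built in: outcome \<open>-1\<close> of either measurement ends in a
  rejecting leaf.\<close>

definition bell_step :: "nat \<Rightarrow> nat \<Rightarrow> protocol \<Rightarrow> protocol" where
  "bell_step a b Q = Measure (local_op a (X_mat \<Otimes> Y_mat) b)
     (Measure (local_op a (Y_mat \<Otimes> X_mat) b) (Discard a (Discard a Q)) (Halt False)) (Halt False)"

lemma valid_bell_step:
  assumes "valid m Q (a + b)" "a + 2 + b \<noteq> m"
  shows "valid m (bell_step a b Q) (a + 2 + b)"
  using assms local_op_in_pauli_ops[of X_mat Y_mat a b] local_op_in_pauli_ops[of Y_mat X_mat a b]
  by (simp add: bell_step_def)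

text \<open>The two components may differ in \<open>L\<close> and \<open>A\<close> but share the
  noisy factors \<open>B\<close> and \<open>R\<close>; the step consumes one pair and multiplies
  each weight by its Bell weight. The carrier assumption on the final output lets the zero matrices
  of the rejecting leaves drop out of the sum.\<close>

lemma run_bell_step:
  fixes x y :: complex
  assumes L: "L \<in> carrier_mat (2 ^ a) (2 ^ a)" "L' \<in> carrier_mat (2 ^ a) (2 ^ a)"
    and R: "R \<in> carrier_mat (2 ^ b) (2 ^ b)"
    and A: "A \<in> carrier_mat 2 2" "A' \<in> carrier_mat 2 2" and B: "B \<in> carrier_mat 2 2"
  defines "\<rho> \<equiv> (x * bell_weight A B) \<cdot>\<^sub>m (L \<Otimes> R) + (y * bell_weight A' B) \<cdot>\<^sub>m (L' \<Otimes> R)"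
  assumes Q: "run m Q (a + b) \<rho> \<in> carrier_mat (2 ^ m) (2 ^ m)"
  shows "run m (bell_step a b Q) (a + 2 + b)
      (x \<cdot>\<^sub>m (L \<Otimes> (A \<Otimes> B) \<Otimes> R) + y \<cdot>\<^sub>m (L' \<Otimes> (A' \<Otimes> B) \<Otimes> R)) = run m Q (a + b) \<rho>"
proof -
  let ?n = "a + 2 + b"
  have S: "A \<Otimes> B \<in> carrier_mat 4 4" "A' \<Otimes> B \<in> carrier_mat 4 4"
    using tensor_carrier[OF A(1) B] tensor_carrier[OF A(2) B] by simp_all
  have S': "XY_projector * (A \<Otimes> B) * XY_projector \<in> carrier_mat 4 4"
    "XY_projector * (A' \<Otimes> B) * XY_projector \<in> carrier_mat 4 4"
    using S by (auto intro!: mult_carrier_mat projector_carrier)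
  note c = tensor_pair_carrier[OF L(1) _ R] tensor_pair_carrier[OF L(2) _ R]
  have XY: "measured a b (X_mat \<Otimes> Y_mat) (x \<cdot>\<^sub>m (L \<Otimes> (A \<Otimes> B) \<Otimes> R) + y \<cdot>\<^sub>m (L' \<Otimes> (A' \<Otimes> B) \<Otimes> R)) =
      x \<cdot>\<^sub>m (L \<Otimes> (XY_projector * (A \<Otimes> B) * XY_projector) \<Otimes> R) +
      y \<cdot>\<^sub>m (L' \<Otimes> (XY_projector * (A' \<Otimes> B) * XY_projector) \<Otimes> R)"
    by (simp only: measured_linear[OF disjI1[OF refl] c(1)[OF S(1)] c(2)[OF S(2)]]
        measured_XY_YX(1)[OF L(1) R A(1) B] measured_XY_YX(1)[OF L(2) R A(2) B])
  have YX: "measured a b (Y_mat \<Otimes> X_mat) (x \<cdot>\<^sub>m (L \<Otimes> (XY_projector * (A \<Otimes> B) * XY_projector) \<Otimes> R) +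
      y \<cdot>\<^sub>m (L' \<Otimes> (XY_projector * (A' \<Otimes> B) * XY_projector) \<Otimes> R)) =
      (x * bell_weight A B) \<cdot>\<^sub>m (L \<Otimes> bell_projector \<Otimes> R) +
      (y * bell_weight A' B) \<cdot>\<^sub>m (L' \<Otimes> bell_projector \<Otimes> R)"
    by (simp only: measured_linear[OF disjI2[OF refl] c(1)[OF S'(1)] c(2)[OF S'(2)]]
        measured_XY_YX(2)[OF L(1) R A(1) B] measured_XY_YX(2)[OF L(2) R A(2) B] smult_smult_mat)
  have pc: "partial_trace ?n a (M \<Otimes> bell_projector \<Otimes> R) \<in> carrier_mat (2 ^ (a + 1 + b)) (2 ^ (a + 1 + b))"
    if "M \<in> carrier_mat (2 ^ a) (2 ^ a)" for M
  proof -
    have K: "bra_at ?n a \<beta> \<in> carrier_mat (2 ^ (a + 1 + b)) (2 ^ ?n)" for \<beta>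
      using bra_at_carrier[of a ?n \<beta>] by simp
    show ?thesis
      unfolding partial_trace_def
      by (intro add_carrier_mat mult_carrier_mat[OF mult_carrier_mat[OF K
            tensor_pair_carrier[OF that projector_carrier(3) R]] mat_adjoint_carrier[OF K]])
  qed
  have "partial_trace (a + 1 + b) a (partial_trace ?n a
      ((x * bell_weight A B) \<cdot>\<^sub>m (L \<Otimes> bell_projector \<Otimes> R) +
       (y * bell_weight A' B) \<cdot>\<^sub>m (L' \<Otimes> bell_projector \<Otimes> R))) = \<rho>"
    unfolding \<rho>_def
    by (simp add: partial_trace_linear[OF _ c(1)[OF projector_carrier(3)] c(2)[OF projector_carrier(3)]]
        partial_trace_linear[OF _ pc[OF L(1)] pc[OF L(2)]]
        partial_trace_bell[OF L(1) R] partial_trace_bell[OF L(2) R]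
        del: add_2_eq_Suc add_2_eq_Suc' One_nat_def)
  moreover have "?n - 1 = a + 1 + b" "a + 1 + b - 1 = a + b" by simp_all
  ultimately show ?thesis
    unfolding bell_step_def run.simps XY YX if_False using Q by simp
qed

text \<open>The pairing is nested: each step takes the last remaining qubit of the first block and
  the first qubit of the second. These are adjacent, so no qubits have to be permuted, and qubit 0
  survives.\<close>

primrec bell_protocol :: "nat \<Rightarrow> protocol" where
  "bell_protocol 0 = Halt True"
| "bell_protocol (Suc k) = bell_step (Suc k) k (bell_protocol k)"

lemma valid_bell_protocol: "valid 1 (bell_protocol k) (Suc k + k)"
proof (induction k)
  case (Suc k)
  have n: "Suc (Suc k) + Suc k = Suc k + 2 + k" by simp
  show ?case unfolding n bell_protocol.simps by (rule valid_bell_step[OF Suc.IH]) simp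
qed simp

text \<open>Induction on the number of pairs, with \<open>x\<close> and \<open>y\<close> arbitrary
  because each step multiplies them by Bell weights.\<close>

lemma run_bell_protocol:
  assumes A: "A \<in> carrier_mat 2 2" "A' \<in> carrier_mat 2 2" and B: "B \<in> carrier_mat 2 2"
  shows "run 1 (bell_protocol k) (Suc k + k)
      (x \<cdot>\<^sub>m (tensor_pow A (Suc k) \<Otimes> tensor_pow B k) + y \<cdot>\<^sub>m (tensor_pow A' (Suc k) \<Otimes> tensor_pow B k)) =
    (x * bell_weight A B ^ k) \<cdot>\<^sub>m A + (y * bell_weight A' B ^ k) \<cdot>\<^sub>m A'"
proof (induction k arbitrary: x y)
  case (Suc k)
  have split: "tensor_pow C (Suc (Suc k)) \<Otimes> tensor_pow B (Suc k) =
      tensor_pow C (Suc k) \<Otimes> (C \<Otimes> B) \<Otimes> tensor_pow B k" for C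
    unfolding tensor_pow_Suc_right[of C "Suc k"] tensor_pow.simps(2)[of B k] by (simp only: tensor_assoc)
  have n: "Suc (Suc k) + Suc k = Suc k + 2 + k" by simp
  have c: "(x * bell_weight A B * bell_weight A B ^ k) \<cdot>\<^sub>m A +
      (y * bell_weight A' B * bell_weight A' B ^ k) \<cdot>\<^sub>m A' \<in> carrier_mat (2 ^ 1) (2 ^ 1)"
    using A by simp
  show ?case
    unfolding split n bell_protocol.simps
    \<comment> \<open>The induction hypothesis makes the remaining output explicit, both in the
      result and in the carrier condition of \<open>run_bell_step\<close>, which \<open>c\<close>
      then settles.\<close>
    by (subst run_bell_step[OF tensor_pow_carrier[OF A(1)] tensor_pow_carrier[OF A(2)]
          tensor_pow_carrier[OF B] A B]; unfold Suc.IH)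
      (rule c, simp only: power_Suc mult.assoc)
qed simp

section \<open>Noisy T-states\<close>

lemma tau_carrier: "tau0 \<in> carrier_mat 2 2" "tau1 \<in> carrier_mat 2 2" "tau f \<in> carrier_mat 2 2"
  by (intro carrier_matI; simp add: tau_def tau0_def tau1_def)+

text \<open>The Bloch vector of \<open>tau f\<close> has three equal components
  \<open>(2 * f - 1) / sqrt 3\<close>.\<close>

lemma tau_index:
  "tau f $$ (0, 0) = (1 + complex_of_real ((2 * f - 1) / sqrt 3)) / 2"
  "tau f $$ (0, Suc 0) = (1 - \<i>) * complex_of_real ((2 * f - 1) / sqrt 3) / 2"
  "tau f $$ (Suc 0, 0) = (1 + \<i>) * complex_of_real ((2 * f - 1) / sqrt 3) / 2"
  "tau f $$ (Suc 0, Suc 0) = (1 - complex_of_real ((2 * f - 1) / sqrt 3)) / 2"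
  by (simp_all add: tau_def tau0_def tau1_def field_simps)

lemma tau_1: "tau 1 = tau0"
  by (rule eq_matI) (auto simp: tau_def tau0_def tau1_def)

text \<open>Together with \<open>tau_1\<close> this puts both components of \<open>sigma_INS\<close>
  into the family \<open>tau\<close>, so that one formula for the Bell weight serves both.\<close>

lemma tau_half: "tau (1 / 2) = (1 / 2) \<cdot>\<^sub>m 1\<^sub>m 2"
  by (rule eq_matI) (auto simp: tau_def tau0_def tau1_def field_simps)

text \<open>The Bell projector is a quarter of the sum of the identity and the correlators XY, YX
  and ZZ. As all Bloch components are equal, each correlator contributes the same product
  \<open>(2 * g - 1) * (2 * f - 1) / 3\<close>.\<close>

lemma bell_weight_tau: "bell_weight (tau g) (tau f) = complex_of_real ((1 + (2 * g - 1) * (2 * f - 1)) / 4)"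
proof -
  define u v where "u = complex_of_real ((2 * g - 1) / sqrt 3)" and "v = complex_of_real ((2 * f - 1) / sqrt 3)"
  have uv: "u * v = complex_of_real ((2 * g - 1) * (2 * f - 1) / 3)"
    unfolding u_def v_def of_real_mult[symmetric] by simp
  have i2: "\<i> * (\<i> * z) = - z" for z by (simp add: mult.assoc[symmetric])
  have "bell_weight (tau g) (tau f) = (1 + 3 * (u * v)) / 4"
    unfolding bell_weight_def One_nat_def tau_index u_def[symmetric] v_def[symmetric]
    by (simp add: field_simps i2)
  then show ?thesis unfolding uv by simp
qed

lemma tensor_pow_tau_half: "tensor_pow (tau (1 / 2)) n = (1 / 2 ^ n) \<cdot>\<^sub>m 1\<^sub>m (2 ^ n)"
  by (induction n) (simp_all add: tau_half tensor_smult_left tensor_smult_right tensor_one_one smult_smult_mat one_smult_mat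
      mult.commute)

section \<open>The protocol on the given input\<close>

lemma sigma_INS_tensor:
  "sigma_INS n \<Otimes> B =
    complex_of_real (q_max n) \<cdot>\<^sub>m (tensor_pow (tau 1) n \<Otimes> B) +
    complex_of_real (1 - q_max n) \<cdot>\<^sub>m (tensor_pow (tau (1 / 2)) n \<Otimes> B)"
proof -
  have "tensor_pow tau0 n \<in> carrier_mat (2 ^ n) (2 ^ n)" by (rule tensor_pow_carrier[OF tau_carrier(1)])
  then have "sigma_INS n \<Otimes> B = (complex_of_real (q_max n) \<cdot>\<^sub>m tensor_pow tau0 n) \<Otimes> B +
      (complex_of_real (1 - q_max n) \<cdot>\<^sub>m ((1 / 2 ^ n) \<cdot>\<^sub>m 1\<^sub>m (2 ^ n))) \<Otimes> B"
    unfolding sigma_INS_def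
    by (intro tensor_add_left[of _ "2 ^ n" "2 ^ n" _ _ "dim_row B" "dim_col B"]) auto
  then show ?thesis by (simp add: tau_1 tensor_pow_tau_half tensor_smult_left)
qed

lemma run_sigma_INS:
  "run 1 (bell_protocol k) (Suc k + k) (sigma_INS (Suc k) \<Otimes> tensor_pow (tau f) k) =
    complex_of_real (q_max (Suc k) * (f / 2) ^ k) \<cdot>\<^sub>m tau 1 +
    complex_of_real ((1 - q_max (Suc k)) * (1 / 4) ^ k) \<cdot>\<^sub>m tau (1 / 2)"
proof -
  have "bell_weight (tau 1) (tau f) = complex_of_real (f / 2)"
    "bell_weight (tau (1 / 2)) (tau f) = complex_of_real (1 / 4)"
    by (simp_all only: bell_weight_tau) (simp_all add: field_simps)
  then show ?thesis
    unfolding sigma_INS_tensor run_bell_protocol[OF tau_carrier(3) tau_carrier(3) tau_carrier(3)]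
    by (simp only: of_real_mult of_real_power)
qed

text \<open>The states \<open>tau g\<close> have trace one and depend affinely on \<open>g\<close>,
  so normalizing a combination averages the fidelities.\<close>

lemma tau_mix:
  assumes "a + b \<noteq> 0"
  shows "mat_trace (complex_of_real a \<cdot>\<^sub>m tau g + complex_of_real b \<cdot>\<^sub>m tau h) = complex_of_real (a + b)"
    and "(1 / complex_of_real (a + b)) \<cdot>\<^sub>m (complex_of_real a \<cdot>\<^sub>m tau g + complex_of_real b \<cdot>\<^sub>m tau h) =
      tau ((a * g + b * h) / (a + b))"
proof -
  have ab: "complex_of_real a + complex_of_real b \<noteq> 0"
    using assms by (metis of_real_add of_real_eq_0_iff)
  have d: "dim_row (tau x) = 2" "dim_col (tau x) = 2" for x using tau_carrier(3)[of x] by simp_all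
  show "mat_trace (complex_of_real a \<cdot>\<^sub>m tau g + complex_of_real b \<cdot>\<^sub>m tau h) = complex_of_real (a + b)"
    by (simp add: mat_trace_def d numeral_eq_Suc tau_index) (simp add: field_simps)
  show "(1 / complex_of_real (a + b)) \<cdot>\<^sub>m (complex_of_real a \<cdot>\<^sub>m tau g + complex_of_real b \<cdot>\<^sub>m tau h) =
      tau ((a * g + b * h) / (a + b))"
  proof (rule eq_matI, goal_cases)
    case (1 i j)
    then have ij: "i < 2" "j < 2" by (simp_all add: d)
    define u v where "u = tau1 $$ (i, j)" and "v = tau0 $$ (i, j) - tau1 $$ (i, j)"
    have affine: "tau r $$ (i, j) = u + complex_of_real r * v" for r
      using ij tau_carrier by (simp add: tau_def u_def v_def algebra_simps)
    show ?case using ij ab by (simp add: d affine) (simp add: field_simps)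
  qed (simp_all add: d)
qed

text \<open>For \<open>q = 1 / (1 + c)\<close> the ratio of noise to signal
  \<open>(1 - q) / q\<close> is \<open>c\<close>; this is the growing factor that the postselection
  has to beat.\<close>

lemma q_max_bounds:
  "0 < q_max n" "1 - q_max n = q_max n * ((2 * f_st) ^ (n - 1) * (sqrt 3 - 1))"
proof -
  have "0 \<le> (2 * f_st) ^ (n - 1) * (sqrt 3 - 1)" by (simp add: f_st_def)
  then show "0 < q_max n" "1 - q_max n = q_max n * ((2 * f_st) ^ (n - 1) * (sqrt 3 - 1))"
    by (auto simp: q_max_def field_simps)
qed

theorem theorem4:
  fixes f :: real
  assumes "f_st < f" and "f \<le> 1"
  shows "\<exists>f' :: nat \<Rightarrow> real.
    (\<forall>n \<ge> 1. f' n \<in> {0..1} \<and>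
       cc_postselect (n + (n - 1)) 1 (sigma_INS n \<Otimes> tensor_pow (tau f) (n - 1)) (tau (f' n))) \<and>
    f' \<longlonglongrightarrow> 1"
proof (intro exI conjI allI impI)
  \<comment> \<open>\<open>x n\<close> is the ratio of the output weights of the maximally mixed
    state and of \<open>tau0\<close>, and \<open>f' n\<close> is the matching average of the
    fidelities \<open>1 / 2\<close> and \<open>1\<close>.\<close>
  define x where "x n = (sqrt 3 - 1) * (f_st / f) ^ (n - 1)" for n
  define f' where "f' n = (1 + x n / 2) / (1 + x n)" for n
  have fst: "0 < f_st" by (simp add: f_st_def add_pos_pos)
  with assms have f: "0 < f" by simp
  have x: "0 \<le> x n" for n using fst f by (simp add: x_def)
  show "f' n \<in> {0..1}" for n using x[of n] by (simp add: f'_def field_simps)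
  show "cc_postselect (n + (n - 1)) 1 (sigma_INS n \<Otimes> tensor_pow (tau f) (n - 1)) (tau (f' n))"
    if n: "n \<ge> 1" for n
  proof -
    obtain k where k: "n = Suc k" using n by (cases n) auto
    \<comment> \<open>\<open>a\<close> and \<open>b\<close> are the unnormalized output weights of
      \<open>tau 1\<close> and \<open>tau (1 / 2)\<close>; their sum is the acceptance
      probability.\<close>
    define a where "a = q_max n * (f / 2) ^ k"
    define b where "b = (1 - q_max n) * (1 / 4) ^ k"
    let ?\<rho> = "sigma_INS n \<Otimes> tensor_pow (tau f) k"
    have a: "0 < a" using q_max_bounds(1) f by (simp add: a_def)
    \<comment> \<open>Per pair, the noise in \<open>sigma_INS\<close> grows by
      \<open>2 * f_st\<close>, while the projection weighs noise by \<open>1 / 4\<close> and signal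
      by \<open>f / 2\<close>; the net change of the ratio is \<open>f_st / f\<close>.\<close>
    have "2 * f_st * (1 / 4) = f_st / f * (f / 2)" using f by simp
    then have powers: "(2 * f_st) ^ k * (1 / 4) ^ k = (f_st / f) ^ k * (f / 2) ^ k"
      by (simp only: power_mult_distrib[symmetric])
    have "b = q_max n * (sqrt 3 - 1) * ((2 * f_st) ^ k * (1 / 4) ^ k)"
      by (simp only: b_def q_max_bounds(2) k diff_Suc_1 ac_simps)
    also have "\<dots> = a * x n"
      unfolding powers by (simp add: a_def x_def k ac_simps)
    finally have b: "b = a * x n" .
    have ab: "a + b \<noteq> 0" using a x[of n] unfolding b by (smt (verit) mult_nonneg_nonneg)
    have f': "f' n = (a * 1 + b * (1 / 2)) / (a + b)"
    proof -
      have "(a * 1 + b * (1 / 2)) / (a + b) = (a * (1 + x n / 2)) / (a * (1 + x n))"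
        unfolding b by (simp add: algebra_simps)
      then show ?thesis using a by (simp add: f'_def)
    qed
    have run: "run 1 (bell_protocol k) (n + k) ?\<rho> =
        complex_of_real a \<cdot>\<^sub>m tau 1 + complex_of_real b \<cdot>\<^sub>m tau (1 / 2)"
      unfolding k a_def b_def by (rule run_sigma_INS)
    have "sigma_INS n \<in> carrier_mat (2 ^ n) (2 ^ n)"
      using tensor_pow_carrier[OF tau_carrier(1), of n] by (simp add: sigma_INS_def)
    then have "?\<rho> \<in> carrier_mat (2 ^ (n + k)) (2 ^ (n + k))"
      unfolding power_add by (rule tensor_carrier[OF _ tensor_pow_carrier[OF tau_carrier(3)]])
    moreover have "valid 1 (bell_protocol k) (n + k)" unfolding k by (rule valid_bell_protocol)
    moreover have "mat_trace (run 1 (bell_protocol k) (n + k) ?\<rho>) = complex_of_real (a + b)"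
      unfolding run by (rule tau_mix(1)[OF ab])
    moreover have "tau (f' n) = (1 / complex_of_real (a + b)) \<cdot>\<^sub>m run 1 (bell_protocol k) (n + k) ?\<rho>"
      unfolding run f' by (rule tau_mix(2)[OF ab, symmetric])
    moreover have "complex_of_real (a + b) \<noteq> 0" using ab by (simp only: of_real_eq_0_iff not_False_eq_True)
    moreover have "n - 1 = k" by (simp add: k)
    ultimately show ?thesis unfolding cc_postselect_def by metis
  qed
  \<comment> \<open>As \<open>f_st < f\<close>, the ratio lies below one. Shifting the index by
    \<open>Suc\<close> then turns the truncated exponent \<open>n - 1\<close> into
    \<open>k\<close>.\<close>
  have "(\<lambda>k. (f_st / f) ^ k) \<longlonglongrightarrow> 0"
    using fst f assms by (intro LIMSEQ_realpow_zero) simp_all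
  then have "(\<lambda>k. x (Suc k)) \<longlonglongrightarrow> 0"
    unfolding x_def by (auto intro: tendsto_mult_right_zero)
  then have "x \<longlonglongrightarrow> 0" by (rule LIMSEQ_imp_Suc)
  then have "f' \<longlonglongrightarrow> (1 + 0 / 2) / (1 + 0)"
    unfolding f'_def by (intro tendsto_intros) simp_all
  then show "f' \<longlonglongrightarrow> 1" by simp
qed

end
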